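(* Let $\sigma=(D_1,\ldots,D_T)$ be an ordered collection of nonempty groups of data sources and let $D=\bigcup_{t=1}^T D_t$ be the full training set, $|D|=n$. The Asymmetric Data Shapley (ADS) value $\phi^\sigma(z;v,D)$, $z\in D$, is the unique allocation that satisfies the four axioms Efficiency, Linearity, Nullity and Intra-Group Uniform Mutual Dependence (with respect to $\sigma$). It admits the permutation form $$\phi^\sigma(z;v,D)=\sum_{\pi\in\Pi(D)} p_{\pi}\,\bigl[v(\pi^{<z}\cup\{z\})-v(\pi^{<z})\bigr],$$ with weights $$p_{\pi}=\begin{cases}\dfrac{1}{\prod_{t=1}^T(|D_t|!)}, & \pi\in\Pi_\sigma(D),\\[0.6em] 0,&\text{otherwise.}\end{cases}$$
   Context: Elements of $D$ are called data sources (two sources with identical content count as different elements of $D$). The groups $D_1,\dots,D_T$ are pairwise disjoint. A utility function is a map $v:2^D\to\mathbb{R}$. An allocation assigns to every utility function $v$ and every $z\in D$ a real number $\phi^\sigma(z;v,D)$. Notation. $\Pi(D)$ is the set of all $n!$ permutations (linear orderings) of $D$. For $\pi=(z_{o_1},\ldots,z_{o_n})\in\Pi(D)$ and $z=z_{o_j}$, $\pi^{<z}:=\{z_{o_1},\ldots,z_{o_{j-1}}\}$. The group index map $\kappa:D\to\{1,\dots,T\}$ is defined by $\kappa(z)=t$ if and only if $z\in D_t$. $\Pi_\sigma(D)$ is the set of permutations $(z_{o_1},\ldots,z_{o_n})\in\Pi(D)$ that respect $\sigma$, i.e. $\kappa(z_{o_1})\le\cdots\le\kappa(z_{o_n})$.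 For $S\subseteq D\setminus\{z\}$, $\Delta(z\mid S):=v(S\cup\{z\})-v(S)$. Axioms, for an allocation $\phi^\sigma$: Efficiency: $\sum_{z\in D}\phi^\sigma(z;v,D)=v(D)-v(\varnothing)$. Linearity: for scalars $\alpha,\beta$ and utility functions $u,v$, $\phi^\sigma(z;\alpha u+\beta v,D)=\alpha\,\phi^\sigma(z;u,D)+\beta\,\phi^\sigma(z;v,D)$ for all $z\in D$. Nullity: if $v(S\cup\{z\})=v(S)$ for all $S\subseteq D\setminus\{z\}$, then $\phi^\sigma(z;v,D)=0$. Intra-Group Uniform Mutual Dependence (with respect to $\sigma$): if two sources $z_i,z_j\in D$ are mutually dependent, that is, $\Delta(z_i\mid S)=\Delta(z_j\mid S)$ for all $S\subseteq D\setminus\{z_i,z_j\}$, then $\phi^\sigma(z_i;v,D)=\phi^\sigma(z_j;v,D)$ if $\kappa(z_i)=\kappa(z_j)$, and $\phi^\sigma(z_i;v,D)=0$ if $\kappa(z_i)<\kappa(z_j)$.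
   Formalization: Mutual dependence is taken to mean that Δ(z_i|S) and Δ(z_j|S) are both equal to 0 (not merely equal) for all S ⊆ D∖{z_i,z_j}; with mere equality no allocation satisfies the axioms when T ≥ 2. *)

theory Defs
  imports Complex_Main "HOL-Library.FuncSet" "HOL-Library.Disjoint_Sets"
    "HOL-Combinatorics.Multiset_Permutations"
begin

text \<open>
  An ordered collection of groups is a list \<open>\<sigma>\<close> of sets, indexed from 0, so that the
  \<open>t\<close>-th group of the informal text is \<open>\<sigma> ! (t - 1)\<close>. Only the order of the group indices
  matters below.
\<close>

definition sources :: "'a set list \<Rightarrow> 'a set" where
  "sources \<sigma> = \<Union> (set \<sigma>)"

definition group_index :: "'a set list \<Rightarrow> 'a \<Rightarrow> nat" where
  "group_index \<sigma> z = (THE t. t < length \<sigma> \<and> z \<in> \<sigma> ! t)"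

text \<open>
  Utility functions and allocations are extensional functions, so that equality in HOL is equality
  of maps with the intended domains.
\<close>

definition utilities :: "'a set \<Rightarrow> ('a set \<Rightarrow> real) set" where
  "utilities D = Pow D \<rightarrow>\<^sub>E UNIV"

definition allocations :: "'a set \<Rightarrow> (('a set \<Rightarrow> real) \<Rightarrow> 'a \<Rightarrow> real) set" where
  "allocations D = utilities D \<rightarrow>\<^sub>E (D \<rightarrow>\<^sub>E UNIV)"

definition marginal :: "('a set \<Rightarrow> real) \<Rightarrow> 'a \<Rightarrow> 'a set \<Rightarrow> real" where
  "marginal v z S = v (S \<union> {z}) - v S"

definition efficiency :: "'a set \<Rightarrow> (('a set \<Rightarrow> real) \<Rightarrow> 'a \<Rightarrow> real) \<Rightarrow> bool" where
  "efficiency D \<phi> \<longleftrightarrow> (\<forall>v \<in> utilities D. (\<Sum>z\<in>D. \<phi> v z) = v D - v {})"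

definition linearity :: "'a set \<Rightarrow> (('a set \<Rightarrow> real) \<Rightarrow> 'a \<Rightarrow> real) \<Rightarrow> bool" where
  "linearity D \<phi> \<longleftrightarrow>
    (\<forall>u \<in> utilities D. \<forall>v \<in> utilities D. \<forall>\<alpha> \<beta>. \<forall>z \<in> D.
      \<phi> (\<lambda>S\<in>Pow D. \<alpha> * u S + \<beta> * v S) z = \<alpha> * \<phi> u z + \<beta> * \<phi> v z)"

definition nullity :: "'a set \<Rightarrow> (('a set \<Rightarrow> real) \<Rightarrow> 'a \<Rightarrow> real) \<Rightarrow> bool" where
  "nullity D \<phi> \<longleftrightarrow>
    (\<forall>v \<in> utilities D. \<forall>z \<in> D.
      (\<forall>S. S \<subseteq> D - {z} \<longrightarrow> v (S \<union> {z}) = v S) \<longrightarrow> \<phi> v z = 0)"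

text \<open>
  Mutual dependence in the sense of Nowak and Radzik: neither source contributes anything in the
  absence of the other, so the two marginals agree with common value 0. The value 0 cannot be
  dropped. If only equality of the marginals were required, then with two groups \<open>{a}\<close>, \<open>{b}\<close>
  and \<open>v S = card S\<close> the last axiom below would give \<open>a\<close> the value 0, while Linearity,
  Nullity and Efficiency, applied to \<open>v\<close> as the sum of the indicators of \<open>a \<in> S\<close> and
  \<open>b \<in> S\<close>, give it the value 1; no allocation would satisfy the axioms.
\<close>

definition mutually_dependent ::
    "'a set \<Rightarrow> ('a set \<Rightarrow> real) \<Rightarrow> 'a \<Rightarrow> 'a \<Rightarrow> bool" where
  "mutually_dependent D v x y \<longleftrightarrow>
    (\<forall>S. S \<subseteq> D - {x, y} \<longrightarrow> marginal v x S = marginal v y S \<and> marginal v y S = 0)"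

definition intra_group_uniform_mutual_dependence ::
    "'a set list \<Rightarrow> (('a set \<Rightarrow> real) \<Rightarrow> 'a \<Rightarrow> real) \<Rightarrow> bool" where
  "intra_group_uniform_mutual_dependence \<sigma> \<phi> \<longleftrightarrow>
    (\<forall>v \<in> utilities (sources \<sigma>). \<forall>x \<in> sources \<sigma>. \<forall>y \<in> sources \<sigma>.
      mutually_dependent (sources \<sigma>) v x y \<longrightarrow>
        (group_index \<sigma> x = group_index \<sigma> y \<longrightarrow> \<phi> v x = \<phi> v y) \<and>
        (group_index \<sigma> x < group_index \<sigma> y \<longrightarrow> \<phi> v x = 0))"

definition satisfies_ADS_axioms ::
    "'a set list \<Rightarrow> (('a set \<Rightarrow> real) \<Rightarrow> 'a \<Rightarrow> real) \<Rightarrow> bool" where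
  "satisfies_ADS_axioms \<sigma> \<phi> \<longleftrightarrow>
    efficiency (sources \<sigma>) \<phi> \<and> linearity (sources \<sigma>) \<phi> \<and> nullity (sources \<sigma>) \<phi> \<and>
    intra_group_uniform_mutual_dependence \<sigma> \<phi>"

definition ADS :: "'a set list \<Rightarrow> ('a set \<Rightarrow> real) \<Rightarrow> 'a \<Rightarrow> real" where
  "ADS \<sigma> = (THE \<phi>. \<phi> \<in> allocations (sources \<sigma>) \<and> satisfies_ADS_axioms \<sigma> \<phi>)"

text \<open>Linear orderings of \<open>D\<close> are the lists in \<^const>\<open>permutations_of_set\<close>.\<close>

definition predecessors :: "'a list \<Rightarrow> 'a \<Rightarrow> 'a set" where
  "predecessors \<pi> z = set (takeWhile (\<lambda>x. x \<noteq> z) \<pi>)"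

definition respecting_permutations :: "'a set list \<Rightarrow> 'a list set" where
  "respecting_permutations \<sigma> =
    {\<pi> \<in> permutations_of_set (sources \<sigma>). sorted (map (group_index \<sigma>) \<pi>)}"

definition ADS_weight :: "'a set list \<Rightarrow> 'a list \<Rightarrow> real" where
  "ADS_weight \<sigma> \<pi> =
    (if \<pi> \<in> respecting_permutations \<sigma>
     then 1 / (\<Prod>t<length \<sigma>. fact (card (\<sigma> ! t))) else 0)"

end

theory Submission imports Defs begin

text \<open>
  The permutation formula averages marginal contributions over the orderings that respect
  \<open>\<sigma>\<close>; Efficiency comes from telescoping along each ordering, and the last axiom from the fact that
  these orderings put earlier groups first and are permuted by transpositions within a group.
  Uniqueness: on the unanimity game of a nonempty set \<open>T\<close>, any two members of \<open>T\<close> are mutually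
  dependent, so the axioms force the unit of value to be shared equally among the members of \<open>T\<close>
  in the last group meeting \<open>T\<close>. Linearity finishes, since unanimity games span all
  utilities.
\<close>

section \<open>Orderings\<close>

lemma set_predecessors_subset: "predecessors \<pi> z \<subseteq> set \<pi> - {z}"
  unfolding predecessors_def using set_takeWhileD by fastforce

lemma predecessors_append_left:
  "z \<in> set xs \<Longrightarrow> predecessors (xs @ ys) z = predecessors xs z"
  unfolding predecessors_def by (simp add: takeWhile_append1)

lemma predecessors_snoc: "x \<notin> set xs \<Longrightarrow> predecessors (xs @ [x]) x = set xs"
  unfolding predecessors_def by (subst takeWhile_append2) auto

lemma predecessors_map:
  assumes "inj f"
  shows "predecessors (map f \<pi>) (f z) = f ` predecessors \<pi> z"
proof -
  have "(\<lambda>x. x \<noteq> f z) \<circ> f = (\<lambda>x. x \<noteq> z)"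
    using assms by (auto simp: inj_eq)
  then show ?thesis
    unfolding predecessors_def by (simp add: takeWhile_map)
qed

text \<open>Telescoping sum. Induction runs from the right end because appending \<open>x\<close>
  changes no predecessor set of an earlier element.\<close>

lemma sum_marginal_predecessors:
  "distinct \<pi> \<Longrightarrow> (\<Sum>z\<in>set \<pi>. marginal v z (predecessors \<pi> z)) = v (set \<pi>) - v {}"
proof (induction \<pi> rule: rev_induct)
  case Nil
  then show ?case by simp
next
  case (snoc x xs)
  then have "x \<notin> set xs" by simp
  then have "(\<Sum>z\<in>set (xs @ [x]). marginal v z (predecessors (xs @ [x]) z)) =
      marginal v x (set xs) + (\<Sum>z\<in>set xs. marginal v z (predecessors xs z))"
    by (simp add: predecessors_snoc predecessors_append_left)
  with snoc show ?case
    by (simp add: marginal_def)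
qed

lemma predecessors_sorted:
  assumes "sorted (map f \<pi>)" "x \<in> set \<pi>" "y \<in> predecessors \<pi> x"
  shows "f y \<le> f x"
proof -
  obtain ys zs where \<pi>: "\<pi> = ys @ x # zs" "x \<notin> set ys"
    using assms(2) split_list_first by metis
  then have "predecessors \<pi> x = set ys"
    unfolding predecessors_def by (subst \<pi>(1), subst takeWhile_append2) auto
  with assms \<pi> show ?thesis
    by (auto simp: sorted_append)
qed

section \<open>Counting orderings sorted by a key\<close>

lemma sorted_map_filter_append:
  fixes f :: "'a \<Rightarrow> 'b::linorder"
  assumes "sorted (map f xs)"
  shows "filter (\<lambda>x. f x < n) xs @ filter (\<lambda>x. \<not> f x < n) xs = xs"
  using assms
proof (induction xs)
  case Nil
  then show ?case by simp
next
  case (Cons x xs)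
  show ?case
  proof (cases "f x < n")
    case True
    with Cons show ?thesis by simp
  next
    case False
    with Cons.prems have "\<forall>y\<in>set xs. \<not> f y < n" by auto
    with False show ?thesis by (simp add: filter_False)
  qed
qed

text \<open>A list sorted by \<open>f\<close> is a concatenation of arbitrary orderings of the level
  sets, taken in increasing order. The induction splits off the top level; empty levels contribute
  the factor \<open>fact 0 = 1\<close>.\<close>

lemma card_sorted_permutations:
  fixes f :: "'a \<Rightarrow> nat"
  assumes "finite D" "\<And>z. z \<in> D \<Longrightarrow> f z < n"
  shows "card {\<pi> \<in> permutations_of_set D. sorted (map f \<pi>)} =
    (\<Prod>t<n. fact (card {z \<in> D. f z = t}))"
  using assms
proof (induction n arbitrary: D)
  case 0
  then have "D = {}" by blast
  then have "{\<pi> \<in> permutations_of_set D. sorted (map f \<pi>)} = {[]}" by auto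
  then show ?case by simp
next
  case (Suc n)
  define B C where "B = {z \<in> D. f z < n}" and "C = {z \<in> D. f z = n}"
  have D: "D = B \<union> C" "B \<inter> C = {}" "finite B" "finite C"
    using Suc.prems less_Suc_eq by (auto simp: B_def C_def)
  have B: "\<And>z. z \<in> B \<Longrightarrow> f z < n" and C: "\<And>z. z \<in> C \<Longrightarrow> f z = n"
    by (auto simp: B_def C_def)
  let ?P = "\<lambda>D. {\<pi> \<in> permutations_of_set D. sorted (map f \<pi>)}"
  have "bij_betw (\<lambda>(xs, ys). xs @ ys) (?P B \<times> permutations_of_set C) (?P D)"
  proof (rule bij_betw_byWitness
      [where f' = "\<lambda>\<pi>. (filter (\<lambda>x. f x < n) \<pi>, filter (\<lambda>x. \<not> f x < n) \<pi>)"])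
    show "\<forall>p \<in> ?P B \<times> permutations_of_set C.
        (\<lambda>\<pi>. (filter (\<lambda>x. f x < n) \<pi>, filter (\<lambda>x. \<not> f x < n) \<pi>)) (case p of (xs, ys) \<Rightarrow> xs @ ys) = p"
      using B C by (auto simp: permutations_of_set_def filter_empty_conv filter_id_conv)
    show "\<forall>\<pi> \<in> ?P D. (case (filter (\<lambda>x. f x < n) \<pi>, filter (\<lambda>x. \<not> f x < n) \<pi>) of (xs, ys) \<Rightarrow> xs @ ys) = \<pi>"
      by (auto simp: sorted_map_filter_append)
    \<comment> \<open>All keys in the top block equal \<open>n\<close>, so sortedness does not
      constrain its ordering.\<close>
    have const: "sorted (map f ys)" if "set ys = C" for ys
    proof -
      have "map f ys = map (\<lambda>_. n) ys"
        using that C by auto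
      then show ?thesis
        by (simp add: map_replicate_const)
    qed
    show "(\<lambda>(xs, ys). xs @ ys) ` (?P B \<times> permutations_of_set C) \<subseteq> ?P D"
      using B C D const by (fastforce simp: permutations_of_set_def sorted_append intro: less_imp_le)
    show "(\<lambda>\<pi>. (filter (\<lambda>x. f x < n) \<pi>, filter (\<lambda>x. \<not> f x < n) \<pi>)) ` ?P D
        \<subseteq> ?P B \<times> permutations_of_set C"
      using B C D by (auto simp: permutations_of_set_def sorted_filter)
  qed
  then have "card (?P D) = card (?P B) * fact (card C)"
    using D by (simp add: bij_betw_same_card[symmetric] card_cartesian_product)
  also have "card (?P B) = (\<Prod>t<n. fact (card {z \<in> B. f z = t}))"
    using Suc.IH D B by blast
  also have "\<dots> = (\<Prod>t<n. fact (card {z \<in> D. f z = t}))"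
    by (intro prod.cong arg_cong[where f = fact] arg_cong[where f = card]) (auto simp: B_def)
  finally show ?case
    by (simp add: C_def)
qed

section \<open>The permutation formula satisfies the axioms\<close>

lemma group_index_eq:
  assumes "disjoint_family_on (\<lambda>t. \<sigma> ! t) {..<length \<sigma>}" "t < length \<sigma>" "z \<in> \<sigma> ! t"
  shows "group_index \<sigma> z = t"
  unfolding group_index_def
proof (rule the_equality)
  fix s assume "s < length \<sigma> \<and> z \<in> \<sigma> ! s"
  then show "s = t"
    using disjoint_family_onD[OF assms(1), of s t] assms(2,3) by auto
qed (use assms in auto)

lemma group_index_sources:
  assumes "disjoint_family_on (\<lambda>t. \<sigma> ! t) {..<length \<sigma>}" "z \<in> sources \<sigma>"
  shows "group_index \<sigma> z < length \<sigma>" "z \<in> \<sigma> ! group_index \<sigma> z"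
proof -
  obtain t where "t < length \<sigma>" "z \<in> \<sigma> ! t"
    using assms(2) by (auto simp: sources_def in_set_conv_nth)
  then show "group_index \<sigma> z < length \<sigma>" "z \<in> \<sigma> ! group_index \<sigma> z"
    using group_index_eq[OF assms(1)] by auto
qed

lemma card_respecting_permutations:
  assumes "finite (sources \<sigma>)" "disjoint_family_on (\<lambda>t. \<sigma> ! t) {..<length \<sigma>}"
  shows "card (respecting_permutations \<sigma>) = (\<Prod>t<length \<sigma>. fact (card (\<sigma> ! t)))"
proof -
  have "{z \<in> sources \<sigma>. group_index \<sigma> z = t} = \<sigma> ! t" if "t < length \<sigma>" for t
    using that group_index_eq[OF assms(2) that] group_index_sources(2)[OF assms(2)] nth_mem[OF that]
    by (auto simp: sources_def simp del: nth_mem)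
  then show ?thesis
    unfolding respecting_permutations_def
    using card_sorted_permutations[OF assms(1), of "group_index \<sigma>" "length \<sigma>"]
      group_index_sources(1)[OF assms(2)] by simp
qed

text \<open>The weights form the uniform probability distribution on the respecting permutations,
  since the product of factorials is exactly their number.\<close>

lemma sum_ADS_weight:
  assumes "finite (sources \<sigma>)" "disjoint_family_on (\<lambda>t. \<sigma> ! t) {..<length \<sigma>}"
  shows "(\<Sum>\<pi> \<in> permutations_of_set (sources \<sigma>). ADS_weight \<sigma> \<pi>) = 1"
proof -
  let ?c = "\<Prod>t<length \<sigma>. fact (card (\<sigma> ! t)) :: real"
  have "(\<Sum>\<pi> \<in> permutations_of_set (sources \<sigma>). ADS_weight \<sigma> \<pi>) =
      (\<Sum>\<pi> \<in> respecting_permutations \<sigma>. 1 / ?c)"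
    by (rule sum.mono_neutral_cong_right)
      (auto simp: ADS_weight_def respecting_permutations_def assms)
  also have "\<dots> = real (card (respecting_permutations \<sigma>)) / ?c"
    by simp
  also have "real (card (respecting_permutations \<sigma>)) = ?c"
    by (simp add: card_respecting_permutations assms of_nat_prod)
  also have "?c / ?c = 1"
    by (simp add: prod_zero_iff)
  finally show ?thesis .
qed

text \<open>Restricting both arguments places the formula in \<open>allocations\<close>, so that it
  can be the unique extensional object that \<open>ADS\<close> denotes.\<close>

definition permutation_value :: "'a set list \<Rightarrow> ('a set \<Rightarrow> real) \<Rightarrow> 'a \<Rightarrow> real" where
  "permutation_value \<sigma> = (\<lambda>v\<in>utilities (sources \<sigma>). \<lambda>z\<in>sources \<sigma>.
    \<Sum>\<pi> \<in> permutations_of_set (sources \<sigma>).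
      ADS_weight \<sigma> \<pi> * marginal v z (predecessors \<pi> z))"

section \<open>Efficiency, Linearity and Nullity\<close>

lemma permutation_value_allocation: "permutation_value \<sigma> \<in> allocations (sources \<sigma>)"
  unfolding permutation_value_def allocations_def by auto

lemma permutation_value_apply:
  "v \<in> utilities (sources \<sigma>) \<Longrightarrow> z \<in> sources \<sigma> \<Longrightarrow> permutation_value \<sigma> v z =
    (\<Sum>\<pi> \<in> permutations_of_set (sources \<sigma>).
      ADS_weight \<sigma> \<pi> * marginal v z (predecessors \<pi> z))"
  by (simp add: permutation_value_def)

lemma predecessors_permutation:
  "\<pi> \<in> permutations_of_set D \<Longrightarrow> predecessors \<pi> z \<subseteq> D - {z}"
  using set_predecessors_subset[of \<pi> z] by (auto simp: permutations_of_set_def)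

lemma efficiency_permutation_value:
  assumes "finite (sources \<sigma>)" "disjoint_family_on (\<lambda>t. \<sigma> ! t) {..<length \<sigma>}"
  shows "efficiency (sources \<sigma>) (permutation_value \<sigma>)"
  unfolding efficiency_def
proof
  fix v :: "'a set \<Rightarrow> real"
  assume v: "v \<in> utilities (sources \<sigma>)"
  let ?D = "sources \<sigma>"
  have "(\<Sum>z\<in>?D. permutation_value \<sigma> v z) =
      (\<Sum>\<pi> \<in> permutations_of_set ?D.
        ADS_weight \<sigma> \<pi> * (\<Sum>z\<in>?D. marginal v z (predecessors \<pi> z)))"
    using v by (simp add: permutation_value_apply sum_distrib_left) (rule sum.swap)
  also have "\<dots> = (\<Sum>\<pi> \<in> permutations_of_set ?D. ADS_weight \<sigma> \<pi> * (v ?D - v {}))"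
  proof (rule sum.cong[OF refl])
    fix \<pi> assume "\<pi> \<in> permutations_of_set ?D"
    then show "ADS_weight \<sigma> \<pi> * (\<Sum>z\<in>?D. marginal v z (predecessors \<pi> z)) =
        ADS_weight \<sigma> \<pi> * (v ?D - v {})"
      using sum_marginal_predecessors[of \<pi> v] by (auto simp: permutations_of_set_def)
  qed
  also have "\<dots> = v ?D - v {}"
    by (simp add: sum_distrib_right[symmetric] sum_ADS_weight assms)
  finally show "(\<Sum>z\<in>?D. permutation_value \<sigma> v z) = v ?D - v {}" .
qed

lemma linearity_permutation_value: "linearity (sources \<sigma>) (permutation_value \<sigma>)"
  unfolding linearity_def
proof (intro ballI allI)
  fix u v :: "'a set \<Rightarrow> real" and \<alpha> \<beta> z
  assume uv: "u \<in> utilities (sources \<sigma>)" "v \<in> utilities (sources \<sigma>)" and z: "z \<in> sources \<sigma>"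
  let ?D = "sources \<sigma>"
  let ?w = "\<lambda>S\<in>Pow ?D. \<alpha> * u S + \<beta> * v S"
  have "?w \<in> utilities ?D"
    by (simp add: utilities_def)
  \<comment> \<open>Both sets in the marginal lie in \<open>Pow ?D\<close>, where the restricted
    function \<open>?w\<close> takes its intended values.\<close>
  moreover have "marginal ?w z (predecessors \<pi> z) =
      \<alpha> * marginal u z (predecessors \<pi> z) + \<beta> * marginal v z (predecessors \<pi> z)"
    if "\<pi> \<in> permutations_of_set ?D" for \<pi>
    using predecessors_permutation[OF that, of z] z
    by (auto simp: marginal_def algebra_simps)
  ultimately show
    "permutation_value \<sigma> ?w z = \<alpha> * permutation_value \<sigma> u z + \<beta> * permutation_value \<sigma> v z"
    using uv z
    by (simp add: permutation_value_apply sum_distrib_left sum.distrib[symmetric] algebra_simps)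
qed

lemma nullity_permutation_value: "nullity (sources \<sigma>) (permutation_value \<sigma>)"
  unfolding nullity_def
proof (intro ballI impI)
  fix v :: "'a set \<Rightarrow> real" and z
  assume "v \<in> utilities (sources \<sigma>)" "z \<in> sources \<sigma>"
    and null: "\<forall>S. S \<subseteq> sources \<sigma> - {z} \<longrightarrow> v (S \<union> {z}) = v S"
  moreover have "marginal v z (predecessors \<pi> z) = 0"
    if "\<pi> \<in> permutations_of_set (sources \<sigma>)" for \<pi>
    using null predecessors_permutation[OF that, of z] by (simp add: marginal_def)
  ultimately show "permutation_value \<sigma> v z = 0"
    by (simp add: permutation_value_apply)
qed

section \<open>Transpositions and the mutual dependence axiom\<close>

lemma ADS_weight_transpose:
  assumes "x \<in> sources \<sigma>" "y \<in> sources \<sigma>" "group_index \<sigma> x = group_index \<sigma> y"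
  shows "ADS_weight \<sigma> (map (transpose x y) \<pi>) = ADS_weight \<sigma> \<pi>"
proof -
  have "transpose x y ` A = sources \<sigma> \<longleftrightarrow> A = sources \<sigma>" for A
    using assms(1,2) transpose_image_eq[of x "sources \<sigma>" y]
    by (metis inj_image_eq_iff inj_transpose)
  \<comment> \<open>Swapping two members of one group leaves the sequence of group indices of a list
    unchanged, hence also its sortedness.\<close>
  moreover have "group_index \<sigma> \<circ> transpose x y = group_index \<sigma>"
    using assms(3) by (auto simp: transpose_def)
  ultimately have "map (transpose x y) \<pi> \<in> respecting_permutations \<sigma> \<longleftrightarrow>
      \<pi> \<in> respecting_permutations \<sigma>"
    by (simp add: respecting_permutations_def permutations_of_set_def distinct_map)
  then show ?thesis
    by (simp add: ADS_weight_def)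
qed

lemma bij_betw_map_transpose_permutations:
  assumes "x \<in> D" "y \<in> D"
  shows "bij_betw (map (transpose x y)) (permutations_of_set D) (permutations_of_set D)"
proof (rule bij_betw_byWitness[where f' = "map (transpose x y)"])
  have "transpose x y ` D = D"
    using assms by (simp add: transpose_image_eq)
  then show "map (transpose x y) ` permutations_of_set D \<subseteq> permutations_of_set D"
    by (auto simp: permutations_of_set_def distinct_map)
  then show "map (transpose x y) ` permutations_of_set D \<subseteq> permutations_of_set D" .
qed auto

text \<open>If \<open>P\<close> avoids \<open>x\<close>, the transposition fixes it and the two
  marginals agree by dependence. If \<open>P = insert x Q\<close>, both marginals end at the value
  of \<open>Q\<close> with \<open>x\<close> and \<open>y\<close> added; their starting values, at
  \<open>insert y Q\<close> and \<open>insert x Q\<close>, both equal \<open>v Q\<close> because the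
  marginals at \<open>Q\<close> vanish.\<close>

lemma marginal_transpose_image:
  assumes "mutually_dependent D v x y" "P \<subseteq> D - {y}"
  shows "marginal v x (transpose x y ` P) = marginal v y P"
proof (cases "x \<in> P \<and> x \<noteq> y")
  case True
  define Q where "Q = P - {x}"
  have P: "P = insert x Q" "x \<notin> Q" "y \<notin> Q" "Q \<subseteq> D - {x, y}"
    using True assms(2) by (auto simp: Q_def)
  then have "transpose x y ` P = insert y Q"
    by (simp add: transpose_image_eq)
  moreover have "marginal v x Q = 0" "marginal v y Q = 0"
    using assms(1) P(4) by (auto simp: mutually_dependent_def)
  ultimately show ?thesis
    using P(1) by (simp add: marginal_def insert_commute)
next
  case False
  then have P: "x \<notin> P" "y \<notin> P" "P \<subseteq> D - {x, y}"
    using assms(2) by auto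
  then have "transpose x y ` P = P"
    by (simp add: transpose_image_eq)
  then show ?thesis
    using assms(1) P(3) by (simp add: mutually_dependent_def)
qed

lemma mutual_dependence_permutation_value:
  "intra_group_uniform_mutual_dependence \<sigma> (permutation_value \<sigma>)"
  unfolding intra_group_uniform_mutual_dependence_def
proof (intro ballI impI conjI)
  fix v :: "'a set \<Rightarrow> real" and x y
  assume v: "v \<in> utilities (sources \<sigma>)" and xy: "x \<in> sources \<sigma>" "y \<in> sources \<sigma>"
    and dep: "mutually_dependent (sources \<sigma>) v x y"
  let ?D = "sources \<sigma>" and ?t = "transpose x y"
  {
    assume eq: "group_index \<sigma> x = group_index \<sigma> y"
    \<comment> \<open>Reindexing by the transposition puts \<open>x\<close> at the place that
      \<open>y\<close> has in \<pi>, so the sum for \<open>x\<close> can be matched term by term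
      with the sum for \<open>y\<close>.\<close>
    have "permutation_value \<sigma> v x = (\<Sum>\<pi> \<in> permutations_of_set ?D.
        ADS_weight \<sigma> (map ?t \<pi>) * marginal v x (predecessors (map ?t \<pi>) x))"
      using v xy sum.reindex_bij_betw[OF bij_betw_map_transpose_permutations[OF xy],
          of "\<lambda>\<pi>. ADS_weight \<sigma> \<pi> * marginal v x (predecessors \<pi> x)"]
      by (simp add: permutation_value_apply)
    also have "\<dots> = (\<Sum>\<pi> \<in> permutations_of_set ?D.
        ADS_weight \<sigma> \<pi> * marginal v y (predecessors \<pi> y))"
    proof (rule sum.cong[OF refl])
      fix \<pi> assume \<pi>: "\<pi> \<in> permutations_of_set ?D"
      have "predecessors (map ?t \<pi>) x = ?t ` predecessors \<pi> y"
        using predecessors_map[of ?t \<pi> y] by simp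
      then show "ADS_weight \<sigma> (map ?t \<pi>) * marginal v x (predecessors (map ?t \<pi>) x) =
          ADS_weight \<sigma> \<pi> * marginal v y (predecessors \<pi> y)"
        by (simp add: ADS_weight_transpose xy eq
            marginal_transpose_image[OF dep predecessors_permutation[OF \<pi>]])
    qed
    also have "\<dots> = permutation_value \<sigma> v y"
      using v xy by (simp add: permutation_value_apply)
    finally show "permutation_value \<sigma> v x = permutation_value \<sigma> v y" .
  next
    assume less: "group_index \<sigma> x < group_index \<sigma> y"
    have "ADS_weight \<sigma> \<pi> * marginal v x (predecessors \<pi> x) = 0"
      if \<pi>: "\<pi> \<in> permutations_of_set ?D" for \<pi>
    proof (cases "\<pi> \<in> respecting_permutations \<sigma>")
      case True
      \<comment> \<open>Everything before \<open>x\<close> has group index at most that of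
        \<open>x\<close>, so \<open>y\<close> comes later. The marginal of \<open>x\<close> is then
        taken at a set avoiding both sources, where dependence makes it 0.\<close>
      then have "y \<notin> predecessors \<pi> x"
        using predecessors_sorted[of "group_index \<sigma>" \<pi> x y] less xy
        by (auto simp: respecting_permutations_def permutations_of_set_def)
      then have "predecessors \<pi> x \<subseteq> ?D - {x, y}"
        using predecessors_permutation[OF \<pi>, of x] by auto
      then show ?thesis
        using dep by (simp add: mutually_dependent_def)
    qed (simp add: ADS_weight_def)
    then show "permutation_value \<sigma> v x = 0"
      unfolding permutation_value_apply[OF v xy(1)] by (intro sum.neutral ballI)
  }
qed

section \<open>Uniqueness\<close>

definition unanimity :: "'a set \<Rightarrow> 'a set \<Rightarrow> 'a set \<Rightarrow> real" where
  "unanimity D T = (\<lambda>S\<in>Pow D. of_bool (T \<subseteq> S))"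

lemma unanimity_utility: "unanimity D T \<in> utilities D"
  by (simp add: unanimity_def utilities_def)

text \<open>A set avoiding both \<open>x\<close> and \<open>y\<close> still misses one of them after
  the other is added, so it never contains \<open>T\<close> and both marginals are 0. Distinctness
  matters: adding \<open>x\<close> alone may complete \<open>T\<close>.\<close>

lemma mutually_dependent_unanimity:
  assumes "T \<subseteq> D" "x \<in> T" "y \<in> T" "x \<noteq> y"
  shows "mutually_dependent D (unanimity D T) x y"
  using assms unfolding mutually_dependent_def marginal_def unanimity_def by auto

text \<open>\<open>M\<close> is the part of \<open>T\<close> in the last group that meets
  \<open>T\<close>. Sources outside \<open>T\<close> are null, members of \<open>T\<close> in
  earlier groups get 0 by the last axiom, and members of \<open>M\<close> get equal values, whose
  total Efficiency fixes.\<close>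

lemma axioms_unanimity:
  assumes fin: "finite (sources \<sigma>)" and T: "T \<subseteq> sources \<sigma>" and z: "z \<in> sources \<sigma>"
    and ax: "satisfies_ADS_axioms \<sigma> \<phi>"
  defines "M \<equiv> {x \<in> T. \<forall>y\<in>T. group_index \<sigma> y \<le> group_index \<sigma> x}"
  shows "\<phi> (unanimity (sources \<sigma>) T) z = (if z \<in> M then 1 / card M else 0)"
proof -
  let ?D = "sources \<sigma>" and ?g = "group_index \<sigma>"
  let ?\<phi> = "\<phi> (unanimity (sources \<sigma>) T)"
  have dep: "(?g x = ?g y \<longrightarrow> ?\<phi> x = ?\<phi> y) \<and> (?g x < ?g y \<longrightarrow> ?\<phi> x = 0)"
    if "x \<in> T" "y \<in> T" for x y
  proof (cases "x = y")
    case False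
    then show ?thesis
      using ax mutually_dependent_unanimity[OF T that] unanimity_utility[of ?D T] that T
      unfolding satisfies_ADS_axioms_def intra_group_uniform_mutual_dependence_def by blast
  qed simp
  have zero: "?\<phi> x = 0" if x: "x \<in> ?D" "x \<notin> M" for x
  proof (cases "x \<in> T")
    case True
    with x(2) obtain y where "y \<in> T" "?g x < ?g y"
      by (auto simp: M_def not_le)
    with dep True show ?thesis by blast
  next
    case False
    have "unanimity ?D T (S \<union> {x}) = unanimity ?D T S" if "S \<subseteq> ?D - {x}" for S
      using that False x(1) by (auto simp: unanimity_def)
    then show ?thesis
      using ax unanimity_utility[of ?D T] x(1)
      unfolding satisfies_ADS_axioms_def nullity_def by blast
  qed
  show ?thesis
  proof (cases "z \<in> M")
    case True
    have const: "?\<phi> x = ?\<phi> z" if "x \<in> M" for x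
      using that True dep[of x z] by (auto simp: M_def intro: antisym)
    have M: "M \<subseteq> ?D" "finite M"
      using T fin by (auto simp: M_def intro: finite_subset)
    \<comment> \<open>The game of the empty set is constant, so only for nonempty \<open>T\<close>
      is the amount to distribute equal to 1.\<close>
    have "T \<noteq> {}"
      using True by (auto simp: M_def)
    then have "1 = unanimity ?D T ?D - unanimity ?D T {}"
      using T by (auto simp: unanimity_def)
    also have "\<dots> = (\<Sum>x\<in>?D. ?\<phi> x)"
      using ax unanimity_utility[of ?D T]
      by (simp add: satisfies_ADS_axioms_def efficiency_def)
    also have "\<dots> = (\<Sum>x\<in>M. ?\<phi> x)"
      using zero M fin by (intro sum.mono_neutral_right) auto
    also have "\<dots> = card M * ?\<phi> z"
      using const by simp
    finally show ?thesis
      using True M(2) by (cases "card M = 0") (auto simp: field_simps)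
  qed (use zero z in auto)
qed

text \<open>
  If \<open>v\<close> is supported in an upward closed family, then subtracting \<open>v T\<close> times the unanimity game
  of a minimal member \<open>T\<close> leaves a utility supported in the family without \<open>T\<close>, which is again
  upward closed.
\<close>

lemma linear_eq_if_unanimity_eq:
  assumes fin: "finite D" and lin: "linearity D \<phi>" "linearity D \<psi>" and z: "z \<in> D"
    and base: "\<And>T. T \<subseteq> D \<Longrightarrow> \<phi> (unanimity D T) z = \<psi> (unanimity D T) z"
    and v: "v \<in> utilities D"
  shows "\<phi> v z = \<psi> v z"
proof -
  have "\<phi> v z = \<psi> v z"
    if "finite F" "F \<subseteq> Pow D" "\<And>S S'. S \<in> F \<Longrightarrow> S \<subseteq> S' \<Longrightarrow> S' \<subseteq> D \<Longrightarrow> S' \<in> F"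
      "v \<in> utilities D" "\<And>S. S \<subseteq> D \<Longrightarrow> S \<notin> F \<Longrightarrow> v S = 0" for F v
    using that
  proof (induction "card F" arbitrary: F v)
    case 0
    \<comment> \<open>Here \<open>v\<close> is the zero utility. Writing it as a combination with
      zero coefficients lets Linearity give it the value 0; the game \<open>?u\<close> only serves
      as some utility.\<close>
    let ?u = "unanimity D {}"
    have "v S = 0 * ?u S + 0 * ?u S" if "S \<subseteq> D" for S
      using that 0 by simp
    then have "v = (\<lambda>S\<in>Pow D. 0 * ?u S + 0 * ?u S)"
      using \<open>v \<in> utilities D\<close> by (auto simp: utilities_def PiE_def intro!: extensionalityI[of _ "Pow D"])
    moreover have "\<phi> (\<lambda>S\<in>Pow D. 0 * ?u S + 0 * ?u S) z = 0"
      "\<psi> (\<lambda>S\<in>Pow D. 0 * ?u S + 0 * ?u S) z = 0"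
      using lin unanimity_utility[of D "{}"] z unfolding linearity_def by (metis add_0 mult_zero_left)+
    ultimately show ?case by metis
  next
    case (Suc n)
    then have "F \<noteq> {}" by auto
    then obtain T where T: "T \<in> F" "\<And>S. S \<in> F \<Longrightarrow> S \<subseteq> T \<Longrightarrow> S = T"
      using finite_has_minimal[OF \<open>finite F\<close>] by metis
    then have TD: "T \<subseteq> D"
      using Suc.prems(2) by auto
    let ?u = "unanimity D T"
    \<comment> \<open>The coefficient cancels \<open>v\<close> at \<open>T\<close>; the factor 1
      matches the shape of the Linearity axiom.\<close>
    define w where "w = (\<lambda>S\<in>Pow D. 1 * v S + (- v T) * ?u S)"
    have w: "w \<in> utilities D"
      by (simp add: w_def utilities_def)
    have "\<phi> w z = \<psi> w z"
    proof (rule Suc.hyps(1)[of "F - {T}"])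
      show "n = card (F - {T})"
        using Suc.hyps(2) T(1) Suc.prems(1) by simp
      \<comment> \<open>By minimality of \<open>T\<close>, no other member of \<open>F\<close> lies
        below \<open>T\<close>, so removing \<open>T\<close> keeps the family upward closed.\<close>
      show "S' \<in> F - {T}" if "S \<in> F - {T}" "S \<subseteq> S'" "S' \<subseteq> D" for S S'
        using that T(2) Suc.prems(3) by blast
      show "w S = 0" if "S \<subseteq> D" "S \<notin> F - {T}" for S
      proof (cases "S = T")
        case False
        with that have "S \<notin> F" by simp
        \<comment> \<open>Upward closure would put every superset of \<open>T\<close> within
          \<open>D\<close> into \<open>F\<close>; hence the unanimity game vanishes at
          \<open>S\<close>, as \<open>v\<close> does.\<close>
        moreover from this have "\<not> T \<subseteq> S"
          using Suc.prems(3) T(1) that(1) by blast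
        ultimately show ?thesis
          using that Suc.prems(5) by (simp add: w_def unanimity_def)
      qed (use TD in \<open>simp add: w_def unanimity_def\<close>)
    qed (use Suc.prems w in auto)
    moreover have "\<chi> w z = 1 * \<chi> v z + (- v T) * \<chi> ?u z" if "linearity D \<chi>" for \<chi>
      using that Suc.prems(4) unanimity_utility[of D T] z unfolding linearity_def w_def by blast
    ultimately show ?case
      using lin base[OF TD] by (metis add_right_cancel mult_1)
  qed
  \<comment> \<open>For the family of all subsets the support condition is vacuous.\<close>
  from this[of "Pow D" v] fin v show ?thesis by auto
qed

lemma ADS_axioms_unique:
  assumes fin: "finite (sources \<sigma>)"
    and "\<phi> \<in> allocations (sources \<sigma>)" "satisfies_ADS_axioms \<sigma> \<phi>"
    and "\<psi> \<in> allocations (sources \<sigma>)" "satisfies_ADS_axioms \<sigma> \<psi>"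
  shows "\<phi> = \<psi>"
proof -
  have eq: "\<phi> v z = \<psi> v z" if "v \<in> utilities (sources \<sigma>)" "z \<in> sources \<sigma>" for v z
  proof (rule linear_eq_if_unanimity_eq[OF fin, where \<phi> = \<phi> and \<psi> = \<psi>])
    show "linearity (sources \<sigma>) \<phi>" "linearity (sources \<sigma>) \<psi>"
      using assms(3,5) by (simp_all add: satisfies_ADS_axioms_def)
    show "\<phi> (unanimity (sources \<sigma>) T) z = \<psi> (unanimity (sources \<sigma>) T) z" if "T \<subseteq> sources \<sigma>" for T
      by (simp only: axioms_unanimity[OF fin that \<open>z \<in> sources \<sigma>\<close> assms(3)]
          axioms_unanimity[OF fin that \<open>z \<in> sources \<sigma>\<close> assms(5)])
  qed (fact that)+
  \<comment> \<open>Allocations are extensional in the utility and in the source, so agreement on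
    the two domains lifts to equality of functions, one argument at a time.\<close>
  have "\<phi> v = \<psi> v" if "v \<in> utilities (sources \<sigma>)" for v
  proof (rule PiE_ext)
    show "\<phi> v \<in> sources \<sigma> \<rightarrow>\<^sub>E UNIV" "\<psi> v \<in> sources \<sigma> \<rightarrow>\<^sub>E UNIV"
      using assms(2,4) that unfolding allocations_def by (auto dest: PiE_mem)
  qed (use that eq in simp)
  with assms(2,4) show ?thesis
    unfolding allocations_def by (rule PiE_ext)
qed

theorem theorem4p1:
  fixes \<sigma> :: "'a set list"
  assumes "finite (sources \<sigma>)"
    and "\<forall>A \<in> set \<sigma>. A \<noteq> {}"
    and "disjoint_family_on (\<lambda>t. \<sigma> ! t) {..<length \<sigma>}"
  shows "(\<exists>!\<phi>. \<phi> \<in> allocations (sources \<sigma>) \<and> satisfies_ADS_axioms \<sigma> \<phi>) \<and>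
    (\<forall>v \<in> utilities (sources \<sigma>). \<forall>z \<in> sources \<sigma>.
      ADS \<sigma> v z =
        (\<Sum>\<pi> \<in> permutations_of_set (sources \<sigma>).
          ADS_weight \<sigma> \<pi> * (v (predecessors \<pi> z \<union> {z}) - v (predecessors \<pi> z))))"
proof -
  have ax: "satisfies_ADS_axioms \<sigma> (permutation_value \<sigma>)"
    unfolding satisfies_ADS_axioms_def
    using efficiency_permutation_value[OF assms(1,3)] linearity_permutation_value
      nullity_permutation_value mutual_dependence_permutation_value by blast
  have ex1: "\<exists>!\<phi>. \<phi> \<in> allocations (sources \<sigma>) \<and> satisfies_ADS_axioms \<sigma> \<phi>"
    using permutation_value_allocation[of \<sigma>] ax ADS_axioms_unique[OF assms(1)] by blast
  then have "ADS \<sigma> = permutation_value \<sigma>"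
    unfolding ADS_def by (rule the1_equality) (use permutation_value_allocation ax in blast)
  then show ?thesis
    using ex1 by (simp add: permutation_value_apply marginal_def)
qed

end
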